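(* For each integer $d \ge 1$, with $\mathcal K(d)$ the nonnegative-integer-valued random variable defined in the context, $$\mathbb P(\mathcal K(d) \ge 1) \ge 4^{-d}.$$
   Context: For $\mathbf x, \mathbf y \in \mathbb R^d$, $\mathbf x \prec \mathbf y$ (equivalently $\mathbf y \succ \mathbf x$; "$\mathbf x$ is dominated by $\mathbf y$") means $x_j < y_j$ for every $j$; $z_+ := \sum_{j=1}^d z_j$. A point $\mathbf y$ of a point process $S$ is a maximum of $S$ if $\mathbf y \not\prec \mathbf z$ for all points $\mathbf z$ of $S$. Definition of $\mathcal K(d)$: for $g \in \mathbb R$ let $\mathbf x(g) := (g/d,\dots,g/d) \in \mathbb R^d$ and let $\mathcal K_g$ be the number of maxima dominated by $\mathbf x(g)$ in a nonhomogeneous Poisson point process in $\mathbb R^d$ with intensity function $\mathbf z \mapsto \mathbf 1(\mathbf z \not\succ \mathbf x(g))\, e^{-z_+}$. The law of $\mathcal K(d)$ is the mixture $\mathbb E\,\mathcal L(\mathcal K_G)$ with $G$ standard Gumbel, i.e. $\mathbb P(\mathcal K(d) \ge k) = \int_{-\infty}^\infty \mathbb P(\mathcal K_g \ge k)\, e^{-g}\exp(-e^{-g})\,dg$. *)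

theory Defs
  imports "HOL-Probability.Probability" "HOL-Library.Extended_Nat"
begin

text \<open>The order on \<open>real ^ 'd\<close> from the library is not used here: its strict part only
  requires one coordinate to be strictly smaller.\<close>

definition dominated :: "real ^ 'd \<Rightarrow> real ^ 'd \<Rightarrow> bool"  (infix \<open>\<lless>\<close> 50)
  where "x \<lless> y \<longleftrightarrow> (\<forall>j. x $ j < y $ j)"

definition coord_sum :: "real ^ 'd \<Rightarrow> real"
  where "coord_sum z = (\<Sum>j\<in>UNIV. z $ j)"

definition maxima :: "(real ^ 'd) set \<Rightarrow> (real ^ 'd) set"
  where "maxima A = {y \<in> A. \<forall>z\<in>A. \<not> y \<lless> z}"

text \<open>The number of elements of a set, unlike \<^const>\<open>card\<close> equal to \<open>\<infinity>\<close> for infinite sets.\<close>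

definition num_points :: "'a set \<Rightarrow> enat"
  where "num_points A = (if finite A then enat (card A) else \<infinity>)"

text \<open>A Poisson point process with intensity measure \<open>\<mu>\<close>, as a random locally finite set
  of points \<open>S\<close> defined on the probability space \<open>M\<close>. Multiplicities need not be recorded because
  the intensity measures considered are diffuse, so that the process is simple. The Poisson
  probabilities are written out (with \<open>0 ^ 0 = 1\<close>) because \<^const>\<open>poisson_pmf\<close> requires a
  positive rate; a count with infinite mean is infinite almost surely.\<close>

definition poisson_point_process ::
    "'w measure \<Rightarrow> ('w \<Rightarrow> 'a::euclidean_space set) \<Rightarrow> 'a measure \<Rightarrow> bool"
  where "poisson_point_process M S \<mu> \<longleftrightarrow>
    prob_space M \<and> sets \<mu> = sets borel \<and>
    (\<forall>\<omega>\<in>space M. \<forall>A. bounded A \<longrightarrow> finite (S \<omega> \<inter> A)) \<and>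
    (\<forall>B\<in>sets borel. (\<lambda>\<omega>. num_points (S \<omega> \<inter> B)) \<in> measurable M (count_space UNIV)) \<and>
    (\<forall>B\<in>sets borel. emeasure \<mu> B < \<infinity> \<longrightarrow>
      (\<forall>n. measure M {\<omega> \<in> space M. num_points (S \<omega> \<inter> B) = enat n} =
        measure \<mu> B ^ n / fact n * exp (- measure \<mu> B))) \<and>
    (\<forall>B\<in>sets borel. emeasure \<mu> B = \<infinity> \<longrightarrow> (AE \<omega> in M. num_points (S \<omega> \<inter> B) = \<infinity>)) \<and>
    (\<forall>(B :: nat \<Rightarrow> 'a set) I. finite I \<and> (\<forall>i\<in>I. B i \<in> sets borel) \<and> disjoint_family_on B I \<longrightarrow>
      prob_space.indep_vars M (\<lambda>_. count_space UNIV) (\<lambda>i \<omega>. num_points (S \<omega> \<inter> B i)) I)"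

definition diag_point :: "real \<Rightarrow> real ^ 'd"
  where "diag_point g = (\<chi> j. g / real CARD('d))"

definition intensity :: "real \<Rightarrow> (real ^ 'd) measure"
  where "intensity g =
    density lborel (\<lambda>z. ennreal (if \<not> diag_point g \<lless> z then exp (- coord_sum z) else 0))"

text \<open>\<open>num_dominated_maxima g A\<close>, for \<open>A\<close> the Poisson process with intensity measure
  \<^term>\<open>intensity g\<close>, is the random variable \<open>\<K>\<^sub>g\<close>.\<close>

definition num_dominated_maxima :: "real \<Rightarrow> (real ^ 'd) set \<Rightarrow> enat"
  where "num_dominated_maxima g A = num_points {y \<in> maxima A. y \<lless> diag_point g}"

definition gumbel_density :: "real \<Rightarrow> real"
  where "gumbel_density g = exp (- g) * exp (- exp (- g))"

text \<open>The random variable \<open>K\<close> on \<open>Q\<close> has the law of \<open>\<K>(d)\<close>, where \<open>S g\<close> (defined on \<open>M g\<close>)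
  realises, for each \<open>g\<close>, the Poisson process underlying \<open>\<K>\<^sub>g\<close>. The law does not depend on the
  choice of these realisations.\<close>

definition has_K_law ::
    "'q measure \<Rightarrow> ('q \<Rightarrow> nat) \<Rightarrow> (real \<Rightarrow> 'w measure) \<Rightarrow> (real \<Rightarrow> 'w \<Rightarrow> (real ^ 'd) set) \<Rightarrow> bool"
  where "has_K_law Q K M S \<longleftrightarrow>
    prob_space Q \<and> K \<in> measurable Q (count_space UNIV) \<and>
    (\<forall>g. poisson_point_process (M g) (S g) (intensity g)) \<and>
    (\<forall>k. emeasure Q {\<omega> \<in> space Q. K \<omega> \<ge> k} =
      (\<integral>\<^sup>+ g. ennreal (measure (M g) {\<omega> \<in> space (M g). num_dominated_maxima g (S g \<omega>) \<ge> enat k}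
                 * gumbel_density g) \<partial>lborel))"

end

theory Submission
  imports Defs "HOL-Real_Asymp.Real_Asymp"
begin

text \<open>Let \<open>U\<close> consist of the points with all coordinates at least \<open>g/d - ln 2\<close> and let \<open>B \<subseteq> U\<close> be the
  box with all coordinates in \<open>[g/d - ln 2, g/d)\<close>. With \<open>u = e\<^sup>-\<^sup>g\<close> their intensities are \<open>(2\<^sup>d - 1) u\<close>
  and \<open>u\<close>. If the process has no point in \<open>U - B\<close> but at least one in \<open>U\<close>, then some point in \<open>B\<close> is a
  maximum, so \<open>P(\<K>\<^sub>g \<ge> 1) \<ge> exp (- (2\<^sup>d - 2) u) - exp (- (2\<^sup>d - 1) u)\<close>. Under the Gumbel law
  \<open>u\<close> is standard exponential, and the expectation of the lower bound is
  \<open>1 / (2\<^sup>d - 1) - 1 / 2\<^sup>d > 4\<^sup>-\<^sup>d\<close>.\<close>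

section \<open>Point counts and the dominance order\<close>

lemma num_points_eq_0_iff: "num_points A = enat 0 \<longleftrightarrow> A = {}"
  by (auto simp: num_points_def)

lemma num_points_eq_1_iff: "num_points A = enat 1 \<longleftrightarrow> (\<exists>y. A = {y})"
  by (auto simp: num_points_def card_1_singleton_iff)

lemma num_points_ge_1_iff: "enat 1 \<le> num_points A \<longleftrightarrow> A \<noteq> {}"
proof -
  have "1 \<le> card A \<longleftrightarrow> A \<noteq> {}" if "finite A"
    using that card_gt_0_iff[of A] by linarith
  then show ?thesis by (auto simp: num_points_def)
qed

lemma num_dominated_maxima_ge_1_iff:
  "enat 1 \<le> num_dominated_maxima g A \<longleftrightarrow> (\<exists>y\<in>maxima A. y \<lless> diag_point g)"
  unfolding num_dominated_maxima_def num_points_ge_1_iff by blast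

lemma open_dominated_above: "open {z. (y :: real ^ 'd) \<lless> z}"
  unfolding dominated_def Collect_all_eq by (intro open_INT ballI open_Collect_less continuous_intros) auto

lemma open_dominated_below: "open {z. z \<lless> (y :: real ^ 'd)}"
  unfolding dominated_def Collect_all_eq by (intro open_INT ballI open_Collect_less continuous_intros) auto

lemma coord_sum_strict_mono: "y \<lless> z \<Longrightarrow> coord_sum y < coord_sum z"
  unfolding coord_sum_def dominated_def by (intro sum_strict_mono) auto

text \<open>A maximum is isolated in \<open>A\<close>, so its position can be tested through counts in countably many
  sets; this gives measurability of the event that a dominated maximum exists.\<close>

lemma exists_dominated_maximum_iff:
  fixes A :: "(real ^ 'd) set" and x :: "real ^ 'd"
  assumes fin: "\<And>X. bounded X \<Longrightarrow> finite (A \<inter> X)"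
    and base: "topological_basis \<B>"
    and dense: "\<And>V. open V \<Longrightarrow> V \<noteq> {} \<Longrightarrow> \<exists>q\<in>D. q \<in> V"
  shows "(\<exists>y\<in>maxima A. y \<lless> x) \<longleftrightarrow>
    (\<exists>W\<in>\<B>. num_points (A \<inter> W) = enat 1 \<and> num_points (A \<inter> (W \<inter> {z. z \<lless> x})) = enat 1 \<and>
      (\<forall>q\<in>D. num_points (A \<inter> (W \<inter> {z. z \<lless> q})) = enat 0 \<or> num_points (A \<inter> {z. q \<lless> z}) = enat 0))"
    (is "?L \<longleftrightarrow> ?R")
proof
  assume ?L
  then obtain y where y: "y \<in> A" "\<And>z. z \<in> A \<Longrightarrow> \<not> y \<lless> z" "y \<lless> x"
    by (auto simp: maxima_def)
  \<comment> \<open>Only finitely many other points of \<open>A\<close> lie near \<open>y\<close>.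
    Removing them leaves an open neighbourhood, so a basic open set \<open>W\<close> isolates
    \<open>y\<close>.\<close>
  have "finite (A \<inter> ball y 1)" by (rule fin) simp
  then have "open (ball y 1 - (A \<inter> ball y 1 - {y}))"
    by (intro open_Diff finite_imp_closed) auto
  moreover have "y \<in> ball y 1 - (A \<inter> ball y 1 - {y})" by simp
  ultimately obtain W where W: "W \<in> \<B>" "y \<in> W" "W \<subseteq> ball y 1 - (A \<inter> ball y 1 - {y})"
    using base topological_basisE by metis
  have AW: "A \<inter> W = {y}" using W y by blast
  then have "A \<inter> (W \<inter> {z. z \<lless> x}) = {y}" using y by blast
  \<comment> \<open>If \<open>y \<lless> q\<close>, a point above \<open>q\<close> would dominate
    \<open>y\<close>. Otherwise \<open>y\<close>, the only point of \<open>A\<close> in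
    \<open>W\<close>, is not below \<open>q\<close>.\<close>
  moreover have "A \<inter> (W \<inter> {z. z \<lless> q}) = {} \<or> A \<inter> {z. q \<lless> z} = {}" for q
  proof (cases "y \<lless> q")
    case True
    then have "y \<lless> z" if "q \<lless> z" for z
      using that unfolding dominated_def by (meson less_trans)
    then show ?thesis using y by blast
  next
    case False
    moreover have "z = y" if "z \<in> A" "z \<in> W" for z using AW that by blast
    ultimately show ?thesis by auto
  qed
  ultimately show ?R
    unfolding num_points_eq_1_iff num_points_eq_0_iff
    by (intro bexI[OF _ W(1)] conjI ballI exI[of _ y] AW) simp_all
next
  assume ?R
  then obtain W y where W: "A \<inter> W = {y}" "A \<inter> (W \<inter> {z. z \<lless> x}) \<noteq> {}"
    "\<And>q. q \<in> D \<Longrightarrow> A \<inter> (W \<inter> {z. z \<lless> q}) = {} \<or> A \<inter> {z. q \<lless> z} = {}"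
    unfolding num_points_eq_1_iff num_points_eq_0_iff by (metis insert_not_empty)
  have "y \<in> A" "y \<in> W" "y \<lless> x" using W(1,2) by auto
  moreover have "\<not> y \<lless> z" if "z \<in> A" for z
  proof
    assume yz: "y \<lless> z"
    \<comment> \<open>A point \<open>z\<close> dominating \<open>y\<close> leaves an open set
      strictly between them, nonempty by the midpoint. A point \<open>q\<close> of \<open>D\<close>
      in it has \<open>y\<close> below and \<open>z\<close> above, so both counts for
      \<open>q\<close> are nonzero.\<close>
    have "open ({q. y \<lless> q} \<inter> {q. q \<lless> z})"
      by (intro open_Int open_dominated_above open_dominated_below)
    moreover have "(1/2) *\<^sub>R (y + z) \<in> {q. y \<lless> q} \<inter> {q. q \<lless> z}"
      using yz by (auto simp: dominated_def)
    ultimately obtain q where "q \<in> D" "y \<lless> q" "q \<lless> z"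
      using dense by blast
    then have "y \<in> A \<inter> (W \<inter> {z. z \<lless> q})" "z \<in> A \<inter> {z. q \<lless> z}"
      using \<open>y \<in> A\<close> \<open>y \<in> W\<close> \<open>z \<in> A\<close> by simp_all
    with W(3)[OF \<open>q \<in> D\<close>] show False by auto
  qed
  ultimately show ?L by (auto simp: maxima_def)
qed

lemma poisson_point_process_finite:
  assumes "poisson_point_process M S \<mu>" "\<omega> \<in> space M" "bounded A"
  shows "finite (S \<omega> \<inter> A)"
proof -
  have "\<forall>\<omega>\<in>space M. \<forall>A. bounded A \<longrightarrow> finite (S \<omega> \<inter> A)"
    using assms(1) unfolding poisson_point_process_def by (elim conjE)
  then show ?thesis using assms(2,3) by blast
qed

lemma poisson_point_process_count_measurable:
  assumes "poisson_point_process M S \<mu>" "B \<in> sets borel"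
  shows "(\<lambda>\<omega>. num_points (S \<omega> \<inter> B)) \<in> measurable M (count_space UNIV)"
proof -
  have "\<forall>B\<in>sets borel. (\<lambda>\<omega>. num_points (S \<omega> \<inter> B)) \<in> measurable M (count_space UNIV)"
    using assms(1) unfolding poisson_point_process_def by (elim conjE)
  then show ?thesis using assms(2) by blast
qed

lemma poisson_point_process_prob:
  assumes "poisson_point_process M S \<mu>" "B \<in> sets borel" "emeasure \<mu> B < \<infinity>"
  shows "measure M {\<omega> \<in> space M. num_points (S \<omega> \<inter> B) = enat n} =
    measure \<mu> B ^ n / fact n * exp (- measure \<mu> B)"
proof -
  have "\<forall>B\<in>sets borel. emeasure \<mu> B < \<infinity> \<longrightarrow>
      (\<forall>n. measure M {\<omega> \<in> space M. num_points (S \<omega> \<inter> B) = enat n} =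
        measure \<mu> B ^ n / fact n * exp (- measure \<mu> B))"
    using assms(1) unfolding poisson_point_process_def by (elim conjE)
  then show ?thesis using assms(2,3) by blast
qed

text \<open>Makes the lower bound by a subevent legitimate, since \<open>measure\<close> is 0 on
  nonmeasurable sets. With \<open>\<B>\<close> and \<open>D\<close> countable, the event is built by
  countable operations from events about counts in open sets.\<close>

lemma dominated_maximum_event_measurable:
  fixes S :: "'w \<Rightarrow> (real ^ 'd) set"
  assumes P: "poisson_point_process M S \<mu>"
  shows "{\<omega> \<in> space M. num_dominated_maxima g (S \<omega>) \<ge> enat 1} \<in> sets M"
proof -
  obtain \<B> :: "(real ^ 'd) set set" where \<B>: "countable \<B>" "topological_basis \<B>"
    using ex_countable_basis by blast
  obtain D :: "(real ^ 'd) set" where D: "countable D"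
    "\<And>V. open V \<Longrightarrow> V \<noteq> {} \<Longrightarrow> \<exists>q\<in>D. q \<in> V"
    using countable_dense_setE by blast
  have fin: "finite (S \<omega> \<inter> X)" if "\<omega> \<in> space M" "bounded X" for \<omega> X
    using poisson_point_process_finite[OF P] that by blast
  have meas: "{\<omega> \<in> space M. num_points (S \<omega> \<inter> B) = n} \<in> sets M" if "B \<in> sets borel" for B n
  proof -
    have "(\<lambda>\<omega>. num_points (S \<omega> \<inter> B)) \<in> measurable M (count_space UNIV)"
      by (rule poisson_point_process_count_measurable[OF P that])
    from measurable_sets[OF this, of "{n}"] show ?thesis
      by (simp add: vimage_def Int_def conj_commute)
  qed
  have open_base: "W \<in> sets borel" if "W \<in> \<B>" for W
    using topological_basis_open[OF \<B>(2) that] by simp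
  have "{\<omega> \<in> space M. num_dominated_maxima g (S \<omega>) \<ge> enat 1} =
    {\<omega> \<in> space M. \<exists>y\<in>maxima (S \<omega>). y \<lless> diag_point g}"
    unfolding num_dominated_maxima_ge_1_iff ..
  also have "\<dots> = {\<omega> \<in> space M. \<exists>W\<in>\<B>. num_points (S \<omega> \<inter> W) = enat 1 \<and>
      num_points (S \<omega> \<inter> (W \<inter> {z. z \<lless> diag_point g})) = enat 1 \<and>
      (\<forall>q\<in>D. num_points (S \<omega> \<inter> (W \<inter> {z. z \<lless> q})) = enat 0 \<or>
        num_points (S \<omega> \<inter> {z. q \<lless> z}) = enat 0)}"
    by (intro Collect_cong conj_cong refl exists_dominated_maximum_iff[OF fin \<B>(2) D(2)])
  also have "\<dots> \<in> sets M"
    by (intro sets.sets_Collect_countable_Ex' sets.sets_Collect_countable_All'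
        sets.sets_Collect_conj sets.sets_Collect_disj meas sets.Int open_base \<B>(1) D(1)
        borel_open open_dominated_above open_dominated_below)
  finally show ?thesis .
qed

section \<open>Intensities of orthants and boxes\<close>

text \<open>The intensity without truncation: a product of copies of the measure with density
  \<open>exp (- t)\<close> on the line, so that cylinders have product masses.\<close>

definition orthant_measure :: "(real ^ 'd) measure"
  where "orthant_measure = density lborel (\<lambda>z. ennreal (exp (- coord_sum z)))"

lemma sets_orthant_measure: "sets orthant_measure = sets borel"
  by (simp add: orthant_measure_def)

lemma sets_intensity: "sets (intensity g) = sets borel"
  by (simp add: intensity_def)

lemma cylinder_borel [measurable]:
  assumes [measurable]: "A \<in> sets (borel :: real measure)"
  shows "{z :: real ^ 'd. \<forall>j. z $ j \<in> A} \<in> sets borel"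
proof -
  have "(\<lambda>z::real^'d. z $ j) -` A \<inter> space borel \<in> sets borel" for j
    by (intro measurable_sets[OF _ assms]) simp
  then have "(\<Inter>j. (\<lambda>z::real^'d. z $ j) -` A) \<in> sets borel"
    by (intro sets.finite_INT) auto
  also have "(\<Inter>j. (\<lambda>z::real^'d. z $ j) -` A) = {z. \<forall>j. z $ j \<in> A}" by auto
  finally show ?thesis .
qed

lemma coord_sum_borel [measurable]: "coord_sum \<in> borel_measurable borel"
  unfolding coord_sum_def by measurable

text \<open>The density factorises over the coordinates, so Tonelli turns the integral into a power
  of the one-dimensional mass \<open>v\<close>. The coordinates are reindexed by the axis vectors to
  match products over \<open>Basis\<close>.\<close>

lemma emeasure_orthant_measure_cylinder:
  assumes [measurable]: "A \<in> sets borel"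
    and v: "(\<integral>\<^sup>+ t. ennreal (exp (- t) * indicator A t) \<partial>lborel) = ennreal v" "0 \<le> v"
  shows "emeasure (orthant_measure :: (real ^ 'd) measure) {z. \<forall>j. z $ j \<in> A} = ennreal (v ^ CARD('d))"
proof -
  have B: "(Basis :: (real ^ 'd) set) = range (\<lambda>j. axis j 1)"
    by (auto simp: Basis_vec_def)
  have inj: "inj (\<lambda>j. axis j (1::real) :: real ^ 'd)"
    by (auto intro!: injI simp: axis_eq_axis)
  have eq: "ennreal (exp (- coord_sum z)) * indicator {z. \<forall>j. z $ j \<in> A} z =
      (\<Prod>b\<in>Basis. ennreal (exp (- (z \<bullet> b)) * indicator A (z \<bullet> b)))" for z :: "real ^ 'd"
  proof -
    have "(\<Prod>b\<in>Basis. ennreal (exp (- (z \<bullet> b)) * indicator A (z \<bullet> b))) =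
      (\<Prod>j\<in>UNIV. ennreal (exp (- (z $ j)) * indicator A (z $ j)))"
      unfolding B by (subst prod.reindex[OF inj]) (simp add: inner_axis)
    also have "\<dots> = ennreal (\<Prod>j\<in>UNIV. exp (- (z $ j)) * indicator A (z $ j))"
      by (rule prod_ennreal) auto
    also have "(\<Prod>j\<in>UNIV. exp (- (z $ j)) * indicator A (z $ j)) =
      exp (- coord_sum z) * (\<Prod>j\<in>UNIV. indicator A (z $ j))"
      by (simp add: prod.distrib coord_sum_def exp_sum sum_negf[symmetric])
    also have "(\<Prod>j\<in>UNIV. indicator A (z $ j)) = (indicator {z. \<forall>j. z $ j \<in> A} z :: real)"
      by (auto simp: indicator_def)
    finally show ?thesis by (auto simp: indicator_def)
  qed
  have "emeasure (orthant_measure :: (real ^ 'd) measure) {z. \<forall>j. z $ j \<in> A} =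
      (\<integral>\<^sup>+ z. (\<Prod>b\<in>Basis. ennreal (exp (- ((z :: real ^ 'd) \<bullet> b)) * indicator A (z \<bullet> b))) \<partial>lborel)"
    unfolding orthant_measure_def by (subst emeasure_density) (auto simp: eq)
  also have "\<dots> = (\<Prod>b\<in>(Basis :: (real ^ 'd) set). ennreal v)"
    by (subst nn_integral_lborel_prod) (auto simp: v)
  also have "\<dots> = ennreal (v ^ CARD('d))"
    using v(2) by (simp add: ennreal_power)
  finally show ?thesis .
qed

lemma nn_integral_exp_tail:
  "(\<integral>\<^sup>+ t. ennreal (exp (- t) * indicator {c..} t) \<partial>lborel) = ennreal (exp (- c))"
proof -
  have "(\<integral>\<^sup>+ t. ennreal (exp (- t)) * indicator {c..} t \<partial>lborel) = ennreal (0 - (- exp (- c)))"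
  proof (rule nn_integral_FTC_atLeast[where F = "\<lambda>t. - exp (- t)"])
    show "((\<lambda>t. - exp (- t)) \<longlongrightarrow> (0::real)) at_top"
      by real_asymp
  qed (auto intro!: derivative_eq_intros)
  then show ?thesis by (simp add: ennreal_mult' ennreal_indicator)
qed

text \<open>Strict dominance makes the removed orthant open, hence the open half-line.\<close>

lemma nn_integral_exp_tail_open:
  "(\<integral>\<^sup>+ t. ennreal (exp (- t) * indicator {c<..} t) \<partial>lborel) = ennreal (exp (- c))"
proof -
  have "AE t in lborel. t \<noteq> c" by (rule AE_lborel_singleton)
  then have "(\<integral>\<^sup>+ t. ennreal (exp (- t) * indicator {c<..} t) \<partial>lborel) =
      (\<integral>\<^sup>+ t. ennreal (exp (- t) * indicator {c..} t) \<partial>lborel)"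
    by (intro nn_integral_cong_AE) (auto simp: indicator_def elim!: eventually_mono)
  then show ?thesis by (simp add: nn_integral_exp_tail)
qed

lemma nn_integral_exp_interval:
  assumes "a \<le> b"
  shows "(\<integral>\<^sup>+ t. ennreal (exp (- t) * indicator {a..<b} t) \<partial>lborel) = ennreal (exp (- a) - exp (- b))"
proof -
  have "AE t in lborel. t \<noteq> b" by (rule AE_lborel_singleton)
  then have "(\<integral>\<^sup>+ t. ennreal (exp (- t) * indicator {a..<b} t) \<partial>lborel) =
      (\<integral>\<^sup>+ t. ennreal (exp (- t)) * indicator {a..b} t \<partial>lborel)"
    by (intro nn_integral_cong_AE) (auto simp: indicator_def elim!: eventually_mono)
  also have "\<dots> = ennreal (- exp (- b) - (- exp (- a)))"
    using assms by (intro nn_integral_FTC_Icc) (auto intro!: derivative_eq_intros)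
  finally show ?thesis by simp
qed

lemma intensity_eq_orthant_measure:
  assumes [measurable]: "X \<in> sets borel"
  shows "emeasure (intensity g) X =
    emeasure (orthant_measure :: (real ^ 'd) measure) (X - {z. diag_point g \<lless> z})"
proof -
  have [measurable]: "{z :: real ^ 'd. diag_point g \<lless> z} \<in> sets borel"
    by (simp add: open_dominated_above)
  have [measurable]: "Measurable.pred borel (\<lambda>z :: real ^ 'd. diag_point g \<lless> z)"
    by (simp add: pred_def)
  show ?thesis
    unfolding intensity_def orthant_measure_def
    by (simp add: emeasure_density)
       (auto intro!: nn_integral_cong simp: indicator_def)
qed

text \<open>Lowering the corner by \<open>ln 2\<close> doubles the mass of each one-dimensional
  tail, giving \<open>2 ^ CARD('d) * exp (- g)\<close> before truncation. The truncation removes the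
  orthant above \<open>diag_point g\<close>, of mass \<open>exp (- g)\<close>.\<close>

lemma emeasure_intensity_upper_box:
  "emeasure (intensity g :: (real ^ 'd) measure) {z. \<forall>j. z $ j \<in> {g / CARD('d) - ln 2..}} =
    ennreal ((2 ^ CARD('d) - 1) * exp (- g))"
proof -
  define c where "c = g / CARD('d)"
  have pw: "exp (- c) ^ CARD('d) = exp (- g)"
    unfolding c_def by (simp flip: exp_of_nat_mult)
  have pw2: "exp (- (c - ln 2)) ^ CARD('d) = 2 ^ CARD('d) * exp (- g)"
  proof -
    have "exp (- (c - ln 2)) = 2 * exp (- c)" by (simp add: exp_diff exp_minus field_simps)
    then show ?thesis by (simp add: power_mult_distrib pw)
  qed
  have O: "{z :: real ^ 'd. diag_point g \<lless> z} = {z. \<forall>j. z $ j \<in> {c<..}}"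
    by (auto simp: dominated_def diag_point_def c_def)
  have le: "c - ln 2 \<le> c" by simp
  have sub: "{z :: real ^ 'd. \<forall>j. z $ j \<in> {c<..}} \<subseteq> {z. \<forall>j. z $ j \<in> {c - ln 2..}}"
    using le by (auto intro: order_trans[OF le less_imp_le])
  have eO: "emeasure orthant_measure {z :: real ^ 'd. \<forall>j. z $ j \<in> {c<..}} = ennreal (exp (- g))"
    using emeasure_orthant_measure_cylinder[OF _ nn_integral_exp_tail_open[of c], where 'd = 'd] pw by simp
  have eU: "emeasure orthant_measure {z :: real ^ 'd. \<forall>j. z $ j \<in> {c - ln 2..}} =
      ennreal (2 ^ CARD('d) * exp (- g))"
    using emeasure_orthant_measure_cylinder[OF _ nn_integral_exp_tail[of "c - ln 2"], where 'd = 'd] pw2 by simp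
  have "emeasure (intensity g) {z :: real ^ 'd. \<forall>j. z $ j \<in> {c - ln 2..}} =
      emeasure orthant_measure ({z :: real ^ 'd. \<forall>j. z $ j \<in> {c - ln 2..}} - {z. \<forall>j. z $ j \<in> {c<..}})"
    by (subst intensity_eq_orthant_measure) (auto simp only: O cylinder_borel borel_closed closed_real_atLeast)
  also have "\<dots> = emeasure orthant_measure {z :: real ^ 'd. \<forall>j. z $ j \<in> {c - ln 2..}} -
      emeasure orthant_measure {z :: real ^ 'd. \<forall>j. z $ j \<in> {c<..}}"
    by (rule emeasure_Diff[OF _ _ _ sub])
       (simp_all only: eO sets_orthant_measure cylinder_borel borel_open borel_closed
         open_greaterThan closed_atLeast ennreal_neq_top infinity_ennreal_def not_False_eq_True)
  also have "\<dots> = ennreal (2 ^ CARD('d) * exp (- g) - exp (- g))"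
    unfolding eO eU by (rule ennreal_minus) simp
  finally show ?thesis by (simp add: c_def algebra_simps)
qed

text \<open>The shift \<open>ln 2\<close> is the one for which the interval
  \<open>{c - ln 2..<c}\<close> has the same mass \<open>exp (- c)\<close> as the tail beyond
  \<open>c\<close>. The box therefore weighs as much as the removed orthant.\<close>

lemma emeasure_intensity_box:
  "emeasure (intensity g :: (real ^ 'd) measure) {z. \<forall>j. z $ j \<in> {g / CARD('d) - ln 2..<g / CARD('d)}} =
    ennreal (exp (- g))"
proof -
  define c where "c = g / CARD('d)"
  have pw: "exp (- c) ^ CARD('d) = exp (- g)"
    unfolding c_def by (simp flip: exp_of_nat_mult)
  have v: "exp (- (c - ln 2)) - exp (- c) = exp (- c)" by (simp add: exp_diff exp_minus field_simps)
  have "c - ln 2 \<le> c" by simp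
  note int = nn_integral_exp_interval[OF this, unfolded v]
  have "emeasure (intensity g) {z :: real ^ 'd. \<forall>j. z $ j \<in> {c - ln 2..<c}} =
      emeasure orthant_measure ({z :: real ^ 'd. \<forall>j. z $ j \<in> {c - ln 2..<c}} - {z. diag_point g \<lless> z})"
    by (rule intensity_eq_orthant_measure) (simp add: cylinder_borel)
  \<comment> \<open>Points of the box are below \<open>c\<close> in every coordinate, so the
    truncation leaves the box intact.\<close>
  also have "{z :: real ^ 'd. \<forall>j. z $ j \<in> {c - ln 2..<c}} - {z. diag_point g \<lless> z} =
      {z. \<forall>j. z $ j \<in> {c - ln 2..<c}}"
    by (auto simp: dominated_def diag_point_def c_def) (metis less_asym)
  also have "emeasure orthant_measure {z :: real ^ 'd. \<forall>j. z $ j \<in> {c - ln 2..<c}} = ennreal (exp (- g))"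
    using emeasure_orthant_measure_cylinder[OF _ int, where 'd = 'd] pw by simp
  finally show ?thesis by (simp add: c_def)
qed

section \<open>Lower bound for fixed \<open>g\<close>\<close>

text \<open>A point of the box with the largest coordinate sum is a maximum.\<close>

lemma exists_dominated_maximum_in_box:
  fixes A :: "(real ^ 'd) set"
  assumes fin: "finite (A \<inter> {z. \<forall>j. z $ j \<in> {a..<c}})"
    and ne: "A \<inter> {z. \<forall>j. z $ j \<in> {a..}} \<noteq> {}"
    and emp: "A \<inter> ({z. \<forall>j. z $ j \<in> {a..}} - {z. \<forall>j. z $ j \<in> {a..<c}}) = {}"
  shows "\<exists>y\<in>maxima A. \<forall>j. y $ j < c"
proof -
  define B where "B = A \<inter> {z. \<forall>j. z $ j \<in> {a..<c}}"
  have above: "z \<in> B" if "z \<in> A" "\<forall>j. a \<le> z $ j" for z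
    using emp that unfolding B_def by auto
  have "B \<noteq> {}" using ne above by auto
  moreover have finB: "finite (coord_sum ` B)" using fin unfolding B_def by simp
  ultimately have "Max (coord_sum ` B) \<in> coord_sum ` B" by (intro Max_in) simp_all
  then obtain y where y: "y \<in> B" "Max (coord_sum ` B) = coord_sum y" by (rule imageE) simp
  have le: "coord_sum z \<le> coord_sum y" if "z \<in> B" for z
    unfolding y(2)[symmetric] using finB that by simp
  have "\<not> y \<lless> z" if "z \<in> A" for z
  proof
    assume yz: "y \<lless> z"
    \<comment> \<open>Dominating a point of the box keeps \<open>z\<close> above \<open>a\<close>.
      By \<open>above\<close> it is then in the box itself, where its larger coordinate sum
      contradicts the choice of \<open>y\<close>.\<close>
    have "\<forall>j. a \<le> z $ j"
      using y(1) yz unfolding B_def dominated_def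
      by (auto intro: order_trans[OF _ less_imp_le])
    then have "z \<in> B" using above that by blast
    then show False using le coord_sum_strict_mono[OF yz] by force
  qed
  then show ?thesis using y(1) by (auto simp: B_def maxima_def)
qed

text \<open>An empty \<open>U\<close> forces an empty \<open>U - B\<close>, so the probability that
  \<open>U - B\<close> is empty and \<open>U\<close> is not is a difference of two void
  probabilities.\<close>

lemma prob_dominated_maximum_ge:
  fixes S :: "'w \<Rightarrow> (real ^ 'd) set"
  assumes P: "poisson_point_process M S (intensity g)"
  shows "exp (- ((2 ^ CARD('d) - 2) * exp (- g))) - exp (- ((2 ^ CARD('d) - 1) * exp (- g)))
    \<le> measure M {\<omega> \<in> space M. num_dominated_maxima g (S \<omega>) \<ge> enat 1}"
proof -
  define c where "c = g / CARD('d)"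
  define U where "U = {z :: real ^ 'd. \<forall>j. z $ j \<in> {c - ln 2..}}"
  define B where "B = {z :: real ^ 'd. \<forall>j. z $ j \<in> {c - ln 2..<c}}"
  interpret prob_space M using P unfolding poisson_point_process_def by (elim conjE)
  have fin: "finite (S \<omega> \<inter> X)" if "\<omega> \<in> space M" "bounded X" for \<omega> X
    using poisson_point_process_finite[OF P] that by blast
  \<comment> \<open>Void probabilities: the case \<open>n = 0\<close> of the Poisson counts.\<close>
  have prob_empty: "{\<omega> \<in> space M. S \<omega> \<inter> X = {}} \<in> sets M"
      "measure M {\<omega> \<in> space M. S \<omega> \<inter> X = {}} = exp (- m)"
    if X: "X \<in> sets borel" "emeasure (intensity g) X = ennreal m" "0 \<le> m" for X m
  proof -
    have "(\<lambda>\<omega>. num_points (S \<omega> \<inter> X)) \<in> measurable M (count_space UNIV)"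
      by (rule poisson_point_process_count_measurable[OF P X(1)])
    from measurable_sets[OF this, of "{enat 0}"] show "{\<omega> \<in> space M. S \<omega> \<inter> X = {}} \<in> sets M"
      by (simp add: vimage_def Int_def conj_commute num_points_eq_0_iff)
    have "measure M {\<omega> \<in> space M. num_points (S \<omega> \<inter> X) = enat 0} =
        measure (intensity g) X ^ 0 / fact 0 * exp (- measure (intensity g) X)"
      using X by (intro poisson_point_process_prob[OF P]) simp_all
    then show "measure M {\<omega> \<in> space M. S \<omega> \<inter> X = {}} = exp (- m)"
      using X by (simp add: num_points_eq_0_iff measure_def)
  qed
  have borel: "U \<in> sets borel" "B \<in> sets borel"
    by (simp_all add: U_def B_def cylinder_borel)
  \<comment> \<open>Since \<open>CARD('d)\<close> is at least 1, the mass of \<open>U - B\<close>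
    found below is nonnegative. In dimension 1 it is 0.\<close>
  have two: "(2 :: real) \<le> 2 ^ CARD('d)"
    using power_increasing[of 1 "CARD('d)" "2 :: real"] by (simp add: Suc_le_eq)
  have eU: "emeasure (intensity g) U = ennreal ((2 ^ CARD('d) - 1) * exp (- g))"
    unfolding U_def c_def by (rule emeasure_intensity_upper_box)
  have eB: "emeasure (intensity g) B = ennreal (exp (- g))"
    unfolding B_def c_def by (rule emeasure_intensity_box)
  have "emeasure (intensity g) (U - B) = emeasure (intensity g) U - emeasure (intensity g) B"
    using borel by (intro emeasure_Diff) (simp_all add: eB sets_intensity, auto simp: U_def B_def)
  also have "\<dots> = ennreal ((2 ^ CARD('d) - 1) * exp (- g) - exp (- g))"
    unfolding eU eB by (rule ennreal_minus) simp
  finally have eC: "emeasure (intensity g) (U - B) = ennreal ((2 ^ CARD('d) - 2) * exp (- g))"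
    by (simp add: algebra_simps)
  note pU = prob_empty[OF borel(1) eU] and pC = prob_empty[OF sets.Diff[OF borel] eC]
  \<comment> \<open>Local finiteness then leaves finitely many points in \<open>B\<close>, among
    which a largest coordinate sum exists. The set \<open>U\<close> is unbounded.\<close>
  have "bounded B"
  proof (rule bounded_subset)
    show "B \<subseteq> cbox (\<chi> j. c - ln 2) (\<chi> j. c)"
      by (auto simp: B_def mem_box_cart less_imp_le)
  qed simp
  have "{\<omega> \<in> space M. S \<omega> \<inter> (U - B) = {}} - {\<omega> \<in> space M. S \<omega> \<inter> U = {}}
      \<subseteq> {\<omega> \<in> space M. num_dominated_maxima g (S \<omega>) \<ge> enat 1}"
  proof
    fix \<omega> assume \<omega>: "\<omega> \<in> {\<omega> \<in> space M. S \<omega> \<inter> (U - B) = {}} - {\<omega> \<in> space M. S \<omega> \<inter> U = {}}"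
    then have "\<exists>y\<in>maxima (S \<omega>). \<forall>j. y $ j < c"
      using fin[OF _ \<open>bounded B\<close>]
      by (intro exists_dominated_maximum_in_box[where a = "c - ln 2"]) (auto simp: U_def B_def)
    then show "\<omega> \<in> {\<omega> \<in> space M. num_dominated_maxima g (S \<omega>) \<ge> enat 1}"
      using \<omega> unfolding num_dominated_maxima_ge_1_iff
      by (simp add: dominated_def diag_point_def c_def)
  qed
  then have "measure M ({\<omega> \<in> space M. S \<omega> \<inter> (U - B) = {}} - {\<omega> \<in> space M. S \<omega> \<inter> U = {}})
      \<le> measure M {\<omega> \<in> space M. num_dominated_maxima g (S \<omega>) \<ge> enat 1}"
    using dominated_maximum_event_measurable[OF P] by (rule finite_measure_mono)
  moreover have "measure M ({\<omega> \<in> space M. S \<omega> \<inter> (U - B) = {}} - {\<omega> \<in> space M. S \<omega> \<inter> U = {}}) =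
      measure M {\<omega> \<in> space M. S \<omega> \<inter> (U - B) = {}} - measure M {\<omega> \<in> space M. S \<omega> \<inter> U = {}}"
    using two by (intro finite_measure_Diff pU(1) pC(1)) auto
  ultimately show ?thesis using pU(2) pC(2) two by simp
qed

section \<open>Integration against the Gumbel density\<close>

text \<open>The Gumbel factor \<open>exp (- exp (- g))\<close> raises the rates \<open>m - 1\<close>
  and \<open>n - 1\<close> to \<open>m\<close> and \<open>n\<close>, and the integrand then has the
  explicit antiderivative \<open>F\<close>, rising from 0 to \<open>1 / m - 1 / n\<close>.\<close>

lemma gumbel_mixture_ge:
  fixes m n :: real
  assumes "0 < m" "m < n" and e: "e < 1 / m - 1 / n"
  shows "ennreal e \<le> (\<integral>\<^sup>+ g. ennreal ((exp (- (m - 1) * exp (- g)) - exp (- (n - 1) * exp (- g)))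
    * gumbel_density g) \<partial>lborel)"
proof -
  define F where "F g = exp (- m * exp (- g)) / m - exp (- n * exp (- g)) / n" for g :: real
  define f where "f g = (exp (- (m - 1) * exp (- g)) - exp (- (n - 1) * exp (- g))) * gumbel_density g" for g
  have f_eq: "f g = exp (- g) * (exp (- m * exp (- g)) - exp (- n * exp (- g)))" for g
    unfolding f_def gumbel_density_def by (simp add: algebra_simps flip: exp_add)
  have f_nonneg: "0 \<le> f g" for g
    using assms by (simp add: f_eq)
  have [measurable]: "f \<in> borel_measurable borel"
    unfolding f_def gumbel_density_def by measurable
  have F': "(F has_real_derivative f g) (at g)" for g
    unfolding F_def f_eq using assms
    by (auto intro!: derivative_eq_intros simp: field_simps)
  have top: "(F \<longlongrightarrow> 1 / m - 1 / n) at_top"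
    unfolding F_def using assms by (real_asymp simp: divide_inverse)
  have "(F \<longlongrightarrow> 0) at_bot"
    unfolding F_def using assms by real_asymp
  \<comment> \<open>The strict bound on \<open>e\<close> leaves room to cut the integral off at a
    finite \<open>a\<close>, where the fundamental theorem on a half-line applies.\<close>
  then have "eventually (\<lambda>a. F a < 1 / m - 1 / n - e) at_bot"
    using e by (intro order_tendstoD) auto
  then obtain a where a: "F a < 1 / m - 1 / n - e"
    by (auto dest: eventually_happens)
  have "ennreal e \<le> ennreal (1 / m - 1 / n - F a)"
    using a by (intro ennreal_leI) simp
  also have "\<dots> = (\<integral>\<^sup>+ g. ennreal (f g) * indicator {a..} g \<partial>lborel)"
    using F' f_nonneg top by (intro nn_integral_FTC_atLeast[symmetric]) auto
  also have "\<dots> \<le> (\<integral>\<^sup>+ g. ennreal (f g) \<partial>lborel)"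
    by (intro nn_integral_mono) (auto simp: indicator_def)
  finally show ?thesis unfolding f_def .
qed

theorem theorem5p2:
  fixes M :: "real \<Rightarrow> 'w measure" and S :: "real \<Rightarrow> 'w \<Rightarrow> (real ^ 'd) set"
    and Q :: "'q measure" and K :: "'q \<Rightarrow> nat"
  assumes "has_K_law Q K M S"
  shows "measure Q {\<omega> \<in> space Q. K \<omega> \<ge> 1} \<ge> 1 / 4 ^ CARD('d)"
proof -
  define N where "N = (2 :: real) ^ CARD('d)"
  have N: "2 \<le> N"
    using power_increasing[of 1 "CARD('d)" "2 :: real"] by (simp add: Suc_le_eq N_def)
  \<comment> \<open>The mixture is used with \<open>m = N - 1\<close> and \<open>n = N\<close>,
    whose value \<open>1 / (N * (N - 1))\<close> strictly exceeds \<open>1 / (N * N)\<close>, the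
    target bound.\<close>
  have "1 / (N * N) < 1 / (N * (N - 1))"
    using N by (intro divide_strict_left_mono mult_strict_left_mono mult_pos_pos) auto
  also have "1 / (N * (N - 1)) = 1 / (N - 1) - 1 / N"
    using N by (simp add: field_simps)
  also have "N * N = 4 ^ CARD('d)"
    by (simp add: N_def flip: power_mult_distrib)
  finally have slack: "1 / 4 ^ CARD('d) < 1 / (N - 1) - 1 / N" .
  interpret prob_space Q using assms unfolding has_K_law_def by (elim conjE)
  have "ennreal (1 / 4 ^ CARD('d)) \<le>
      (\<integral>\<^sup>+ g. ennreal ((exp (- (N - 1 - 1) * exp (- g)) - exp (- (N - 1) * exp (- g)))
        * gumbel_density g) \<partial>lborel)"
    using N slack by (intro gumbel_mixture_ge) auto
  also have "\<dots> \<le> (\<integral>\<^sup>+ g. ennreal (measure (M g) {\<omega> \<in> space (M g). num_dominated_maxima g (S g \<omega>) \<ge> enat 1}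
      * gumbel_density g) \<partial>lborel)"
  proof (intro nn_integral_mono ennreal_leI mult_right_mono)
    fix g
    have "poisson_point_process (M g) (S g) (intensity g)"
      using assms unfolding has_K_law_def by blast
    from prob_dominated_maximum_ge[OF this]
    show "exp (- (N - 1 - 1) * exp (- g)) - exp (- (N - 1) * exp (- g))
        \<le> measure (M g) {\<omega> \<in> space (M g). num_dominated_maxima g (S g \<omega>) \<ge> enat 1}"
      by (simp add: N_def algebra_simps)
    show "0 \<le> gumbel_density g" by (simp add: gumbel_density_def)
  qed
  also have "\<dots> = emeasure Q {\<omega> \<in> space Q. K \<omega> \<ge> 1}"
    using assms unfolding has_K_law_def by metis
  finally show ?thesis by (simp add: emeasure_eq_measure)
qed

end
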